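(* Let $f(x)=1-2|x-1/2|$, $x\in[0,1]$, be the standard tent map, and for a coupling coefficient $c$ consider the system on $[0,1]^2$ $$T:\quad x_1(n+1)=(1-c)f(x_1(n))+cf(x_2(n)),\qquad x_2(n+1)=cf(x_1(n))+(1-c)f(x_2(n)).$$ There exists $0<c_+\le 1/4$ such that if $0\le c<c_+$, then there exists a constant $\gamma_0>0$ such that for Lebesgue almost every initial point $(x_1(0),x_2(0))\in[0,1]^2$, $$\liminf_{n\to\infty}\mathrm{dist}(\mathbf{x}(n),D_{\mathrm{syn}})=0\quad\text{and}\quad \limsup_{n\to\infty}\mathrm{dist}(\mathbf{x}(n),D_{\mathrm{syn}})\ge\gamma_0,$$ where $\mathbf{x}(n)=(x_1(n),x_2(n))$.
   Context: $D_{\mathrm{syn}}=\{(x_1,x_2)\in[0,1]^2: x_1=x_2\}$ and $\mathrm{dist}$ is the Euclidean distance from a point to a set. *)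

theory Defs
  imports "HOL-Analysis.Analysis"
begin

definition tent :: "real \<Rightarrow> real" where
  "tent x = 1 - 2 * \<bar>x - 1/2\<bar>"

definition coupled_tent :: "real \<Rightarrow> real \<times> real \<Rightarrow> real \<times> real" where
  "coupled_tent c p =
     ((1 - c) * tent (fst p) + c * tent (snd p),
      c * tent (fst p) + (1 - c) * tent (snd p))"

definition unit_square :: "(real \<times> real) set" where
  "unit_square = {0..1} \<times> {0..1}"

definition D_syn :: "(real \<times> real) set" where
  "D_syn = {p \<in> unit_square. fst p = snd p}"

end

theory Submission
  imports Defs
begin

text \<open>The quantities \<open>p = \<bar>x\<^sub>1 - x\<^sub>2\<bar>\<close> and \<open>q = \<bar>1 - x\<^sub>1 - x\<^sub>2\<bar>\<close> of the coupled system evolve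
  autonomously by \<open>(p, q) \<mapsto> (k * min p q, \<bar>1 - 2 * max p q\<bar>)\<close> with \<open>k = 2 * (1 - 2 * c)\<close>, and
  \<open>p\<close> is comparable to the distance from the diagonal. Both assertions say that a forward
  invariant set of this map is null.

  For the upper limit, the orbits that satisfy \<open>p \<le> 1/4\<close> during \<open>n\<close> steps form a set whose
  measure shrinks by a factor \<open>3 / (2 * k) < 1\<close> per step.

  For the lower limit, axis-parallel segments are mapped to axis-parallel segments, expanded by at
  least \<open>k\<close>, and are cut only along \<open>p = q\<close>, so expansion beats cutting; a segment that crosses
  \<open>max p q = 1/2\<close> is folded onto \<open>q = 0\<close> and one step later reaches \<open>p = 0\<close>, so a fixed proportion of it
  leaves the set \<open>p \<ge> \<epsilon>\<close>. Fubini finishes the argument.\<close>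

section \<open>Reduction to the folded map in the coordinates \<open>p\<close>,
  \<open>q\<close>\<close>

definition folded_tent :: "real \<Rightarrow> real \<times> real \<Rightarrow> real \<times> real" where
  "folded_tent k z = (k * min (fst z) (snd z), \<bar>1 - 2 * max (fst z) (snd z)\<bar>)"

definition sym_coords :: "real \<times> real \<Rightarrow> real \<times> real" where
  "sym_coords x = (\<bar>fst x - snd x\<bar>, \<bar>1 - fst x - snd x\<bar>)"

text \<open>Since \<open>p + q\<close> equals the larger of |1 - 2 x1| and |1 - 2 x2|, the condition
  \<open>p + q \<le> 1\<close> describes the unit square folded along both of its diagonals.\<close>

definition sym_triangle :: "(real \<times> real) set" where
  "sym_triangle = {z. 0 \<le> fst z \<and> 0 \<le> snd z \<and> fst z + snd z \<le> 1}"

text \<open>The coupling preserves the sum of the two tent values and multiplies their difference by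
  \<open>1 - 2 * c\<close>. With a = x1 - x2 and b = 1 - x1 - x2, the tent values are 1 - |a - b|
  and 1 - |a + b|; the identities for ||a + b| - |a - b|| and |a + b| + |a - b| produce the minimum
  and the maximum.\<close>

lemma sym_coords_coupled_tent:
  assumes "c \<le> 1/2"
  shows "sym_coords (coupled_tent c x) = folded_tent (2 * (1 - 2 * c)) (sym_coords x)"
proof -
  define u v where "u = tent (fst x)" and "v = tent (snd x)"
  have 1: "\<bar>u - v\<bar> = 2 * min (\<bar>fst x - snd x\<bar>) (\<bar>1 - fst x - snd x\<bar>)"
    and 2: "\<bar>1 - u - v\<bar> = \<bar>1 - 2 * max (\<bar>fst x - snd x\<bar>) (\<bar>1 - fst x - snd x\<bar>)\<bar>"
    unfolding u_def v_def tent_def by (auto simp: abs_if min_def max_def)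
  have "(1 - c) * u + c * v - (c * u + (1 - c) * v) = (1 - 2 * c) * (u - v)"
    by (simp add: algebra_simps)
  then have 3: "\<bar>(1 - c) * u + c * v - (c * u + (1 - c) * v)\<bar> = (1 - 2 * c) * \<bar>u - v\<bar>"
    using assms by (simp add: abs_mult)
  have 4: "1 - ((1 - c) * u + c * v) - (c * u + (1 - c) * v) = 1 - u - v"
    by (simp add: algebra_simps)
  show ?thesis
    unfolding sym_coords_def coupled_tent_def folded_tent_def fst_conv snd_conv
      u_def[symmetric] v_def[symmetric] 3 4 1 2
    by simp
qed

lemma sym_coords_coupled_tent_pow:
  assumes "c \<le> 1/2"
  shows "sym_coords ((coupled_tent c ^^ n) x) = (folded_tent (2 * (1 - 2 * c)) ^^ n) (sym_coords x)"
  by (induction n) (simp_all add: sym_coords_coupled_tent[OF assms])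

lemma sym_coords_in_triangle: "x \<in> unit_square \<Longrightarrow> sym_coords x \<in> sym_triangle"
  unfolding unit_square_def sym_coords_def sym_triangle_def by (auto simp: abs_if)

lemma tent_in_unit_interval: "x \<in> {0..1} \<Longrightarrow> tent x \<in> {0..1}"
  unfolding tent_def by (auto simp: abs_if)

lemma coupled_tent_in_unit_square:
  assumes "0 \<le> c" "c \<le> 1" "x \<in> unit_square"
  shows "coupled_tent c x \<in> unit_square"
proof -
  have conv: "(1 - c) * u + c * v \<in> {0..1}" "c * u + (1 - c) * v \<in> {0..1}"
    if "u \<in> {0..1}" "v \<in> {0..1}" for u v :: real
    using that assms convex_bound_le[of u 1 v "1 - c" c] convex_bound_le[of u 1 v c "1 - c"] by auto
  have "tent (fst x) \<in> {0..1}" "tent (snd x) \<in> {0..1}"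
    using assms(3) by (auto simp: unit_square_def intro!: tent_in_unit_interval simp del: atLeastAtMost_iff)
  from conv[OF this] show ?thesis by (simp add: coupled_tent_def unit_square_def)
qed

lemma coupled_tent_pow_in_unit_square:
  assumes "0 \<le> c" "c \<le> 1" "x \<in> unit_square"
  shows "(coupled_tent c ^^ n) x \<in> unit_square"
  by (induction n) (simp_all add: assms coupled_tent_in_unit_square)

lemma infdist_D_syn_le:
  assumes "x \<in> unit_square"
  shows "infdist x D_syn \<le> fst (sym_coords x)"
proof -
  have "infdist x D_syn \<le> dist x (fst x, fst x)"
    using assms by (intro infdist_le) (auto simp: D_syn_def unit_square_def)
  also have "\<dots> = fst (sym_coords x)"
    by (simp add: dist_prod_def sym_coords_def dist_real_def)
  finally show ?thesis .
qed

lemma infdist_D_syn_ge: "fst (sym_coords x) / 2 \<le> infdist x D_syn"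
proof -
  have "fst (sym_coords x) / 2 \<le> dist x y" if "y \<in> D_syn" for y
  proof -
    have "fst y = snd y" using that by (simp add: D_syn_def)
    then show ?thesis
      using dist_fst_le[of x y] dist_snd_le[of x y] by (auto simp: sym_coords_def dist_real_def)
  qed
  \<comment> \<open>Nonemptiness matters: \<open>infdist\<close> to the empty set is 0 by
    convention, and the infimum bound needs an element.\<close>
  moreover have "(0, 0) \<in> D_syn" by (simp add: D_syn_def unit_square_def)
  ultimately have "fst (sym_coords x) / 2 \<le> (INF y\<in>D_syn. dist x y)"
    by (intro cINF_greatest) auto
  with \<open>(0, 0) \<in> D_syn\<close> show ?thesis by (auto simp: infdist_def)
qed

lemma folded_tent_in_triangle:
  assumes "0 \<le> k" "k \<le> 2" "z \<in> sym_triangle"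
  shows "folded_tent k z \<in> sym_triangle"
proof -
  have "0 \<le> min (fst z) (snd z)" using assms(3) by (simp add: sym_triangle_def)
  then have "k * min (fst z) (snd z) \<le> 2 * min (fst z) (snd z)"
    using assms by (intro mult_right_mono)
  with assms \<open>0 \<le> min _ _\<close> show ?thesis
    by (auto simp: sym_triangle_def folded_tent_def abs_if min_def max_def split: if_splits)
qed

lemma folded_tent_pow_in_triangle:
  assumes "0 \<le> k" "k \<le> 2" "z \<in> sym_triangle"
  shows "(folded_tent k ^^ n) z \<in> sym_triangle"
  by (induction n) (simp_all add: assms folded_tent_in_triangle)

lemma folded_tent_swap: "folded_tent k (p, q) = folded_tent k (q, p)"
  by (simp add: folded_tent_def min.commute max.commute)

lemma closed_sym_triangle: "closed sym_triangle"
  unfolding sym_triangle_def by (intro closed_Collect_conj closed_Collect_le continuous_intros)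

lemma continuous_folded_tent_pow: "continuous_on UNIV (folded_tent k ^^ n)"
proof (induction n)
  case (Suc n)
  have "continuous_on UNIV (folded_tent k)"
    unfolding folded_tent_def by (intro continuous_intros)
  with Suc show ?case
    by (auto intro: continuous_on_compose2)
qed (simp add: id_def)

section \<open>Preimages of null sets\<close>

text \<open>The map has four affine inverse branches: \<open>?f\<close> inverts it where
  \<open>p \<le> q\<close>, \<open>?g\<close> where \<open>q \<le> p\<close>, and \<open>s\<close>
  is the sign that tells on which side of 1/2 the maximum lies. The preimage is covered by four
  affine images of \<open>N\<close>.\<close>

lemma negligible_folded_tent_vimage:
  assumes "k \<noteq> 0" "negligible N"
  shows "negligible (folded_tent k -` N)"
proof -
  let ?f = "\<lambda>(s::real) (z::real\<times>real). (fst z / k, (1 + s * snd z) / 2)"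
  let ?g = "\<lambda>(s::real) (z::real\<times>real). ((1 + s * snd z) / 2, fst z / k)"
  have neg: "negligible (?f s ` N)" "negligible (?g s ` N)" for s
    by ((intro negligible_differentiable_image_negligible[OF order.refl assms(2)];
        use assms(1) in \<open>auto simp: differentiable_on_def intro!: derivative_intros
          bounded_linear_imp_differentiable[OF bounded_linear_fst]
          bounded_linear_imp_differentiable[OF bounded_linear_snd]\<close>)+)
  have sub: "folded_tent k -` N \<subseteq> ?f 1 ` N \<union> ?f (-1) ` N \<union> ?g 1 ` N \<union> ?g (-1) ` N"
  proof
    fix z assume "z \<in> folded_tent k -` N"
    then have N: "folded_tent k z \<in> N" by simp
    have "z = ?f 1 (folded_tent k z) \<or> z = ?f (-1) (folded_tent k z) \<or>
      z = ?g 1 (folded_tent k z) \<or> z = ?g (-1) (folded_tent k z)"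
      using assms(1) by (cases z) (auto simp: folded_tent_def min_def max_def abs_if)
    with N show "z \<in> ?f 1 ` N \<union> ?f (-1) ` N \<union> ?g 1 ` N \<union> ?g (-1) ` N" by blast
  qed
  show ?thesis
    by (rule negligible_subset[OF _ sub]) (intro negligible_Un neg)
qed

lemma negligible_folded_tent_pow_vimage:
  assumes "k \<noteq> 0" "negligible N"
  shows "negligible ((folded_tent k ^^ n) -` N)"
proof (induction n)
  case (Suc n)
  have "(folded_tent k ^^ Suc n) -` N = folded_tent k -` ((folded_tent k ^^ n) -` N)"
    by (simp add: vimage_def funpow_swap1)
  then show ?case using negligible_folded_tent_vimage[OF assms(1) Suc] by metis
qed (simp add: assms)

text \<open>Again four affine inverse branches: \<open>s\<close> and \<open>r\<close> are the signs
  of x1 - x2 and 1 - x1 - x2.\<close>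

lemma negligible_sym_coords_vimage:
  assumes "negligible N"
  shows "negligible (sym_coords -` N)"
proof -
  let ?f = "\<lambda>(r::real) (s::real) (z::real\<times>real). ((1 - r * snd z + s * fst z) / 2, (1 - r * snd z - s * fst z) / 2)"
  have neg: "negligible (?f r s ` N)" for r s
    by (intro negligible_differentiable_image_negligible[OF order.refl assms])
       (auto simp: differentiable_on_def intro!: derivative_intros
          bounded_linear_imp_differentiable[OF bounded_linear_fst]
          bounded_linear_imp_differentiable[OF bounded_linear_snd])
  have sub: "sym_coords -` N \<subseteq> ?f 1 1 ` N \<union> ?f 1 (-1) ` N \<union> ?f (-1) 1 ` N \<union> ?f (-1) (-1) ` N"
  proof
    fix z assume "z \<in> sym_coords -` N"
    then have N: "sym_coords z \<in> N" by simp
    have "z = ?f 1 1 (sym_coords z) \<or> z = ?f 1 (-1) (sym_coords z) \<or>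
      z = ?f (-1) 1 (sym_coords z) \<or> z = ?f (-1) (-1) (sym_coords z)"
      by (cases z) (auto simp: sym_coords_def abs_if)
    with N show "z \<in> ?f 1 1 ` N \<union> ?f 1 (-1) ` N \<union> ?f (-1) 1 ` N \<union> ?f (-1) (-1) ` N" by blast
  qed
  show ?thesis
    by (rule negligible_subset[OF _ sub]) (intro negligible_Un neg)
qed

section \<open>One-dimensional slices of a trapped set\<close>

lemma measure_le_affine:
  fixes X Y :: "real set"
  assumes "m \<noteq> 0" "X \<in> sets borel" "Y \<in> sets borel" "bounded Y" "\<And>t. t \<in> X \<Longrightarrow> m * t + d \<in> Y"
  shows "measure lebesgue X \<le> measure lebesgue Y / \<bar>m\<bar>"
proof -
  let ?f = "\<lambda>y. - d / m + (1 / m) *\<^sub>R y"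
  have f: "t = ?f (m * t + d)" "y = m * ?f y + d" for t y
    using assms(1) by (simp_all add: field_simps)
  then have image: "?f ` Y = (\<lambda>t. m * t + d) -` Y" by (auto simp: image_iff simp del: divide_minus_left)
  also have "\<dots> \<in> sets borel"
    using measurable_sets[of "\<lambda>t. m * t + d" borel borel Y] assms(3) by simp
  finally have "?f ` Y \<in> sets borel" .
  moreover have "bounded (?f ` Y)"
    using bounded_translation[OF bounded_scaling[OF assms(4), of "1 / m"], of "- d / m"]
    by (simp add: image_image)
  ultimately have "?f ` Y \<in> lmeasurable"
    by (intro bounded_set_imp_lmeasurable) auto
  moreover have "X \<subseteq> ?f ` Y" unfolding image using assms(5) by auto
  ultimately have "measure lebesgue X \<le> measure lebesgue (?f ` Y)"
    using assms(2) by (intro measure_mono_fmeasurable) auto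
  also have "\<dots> = measure lebesgue Y / \<bar>m\<bar>"
    using measure_lebesgue_affine[of "1 / m" "- d / m" Y] by simp
  finally show ?thesis .
qed

text \<open>Only horizontal slices are measured; for a set symmetric under exchange of coordinates
  they stand for the vertical ones as well.\<close>

definition slice_measure :: "(real \<times> real) set \<Rightarrow> real \<Rightarrow> real \<Rightarrow> real \<Rightarrow> real" where
  "slice_measure E w a b = measure lebesgue {t \<in> {a..b}. (t, w) \<in> E}"

text \<open>The segment from \<open>(a, w)\<close> to \<open>(b, w)\<close> lies in
  \<open>sym_triangle\<close>; in particular \<open>b - a \<le> 1\<close>.\<close>

definition valid_slice :: "real \<Rightarrow> real \<Rightarrow> real \<Rightarrow> bool" where
  "valid_slice w a b \<longleftrightarrow> 0 \<le> w \<and> 0 \<le> a \<and> a \<le> b \<and> b + w \<le> 1"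

text \<open>Abstracts the set of orbits that never come near \<open>p = 0\<close>. Symmetry lets a
  vertical image segment be read as a horizontal one; \<open>away\<close> looks two steps ahead
  because the fold at \<open>max p q = 1/2\<close> reaches \<open>p = 0\<close> only after two
  steps.\<close>

locale folded_tent_trapped =
  fixes k :: real and E :: "(real \<times> real) set" and \<epsilon> :: real
  assumes k: "9/5 \<le> k" "k \<le> 2"
    and borel: "E \<in> sets borel"
    and swap: "(p, q) \<in> E \<Longrightarrow> (q, p) \<in> E"
    and invariant: "z \<in> E \<Longrightarrow> folded_tent k z \<in> E"
    and \<epsilon>: "0 < \<epsilon>" "\<epsilon> \<le> 1"
    and away: "z \<in> E \<Longrightarrow> \<epsilon> \<le> fst (folded_tent k (folded_tent k z))"
begin

lemma slice_borel: "{t \<in> {a..b}. (t, w) \<in> E} \<in> sets borel"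
proof -
  have "(\<lambda>t. (t, w)) -` E \<inter> space borel \<in> sets borel"
    by (rule measurable_sets[OF _ borel]) simp
  then have "{a..b} \<inter> (\<lambda>t. (t, w)) -` E \<in> sets borel" by simp
  then show ?thesis by (simp add: vimage_def Int_def)
qed

lemma slice_bounded: "bounded {t \<in> {a..b}. (t, w) \<in> E}"
  by (rule bounded_subset[OF bounded_closed_interval[of a b]]) auto

lemma slice_lmeasurable: "{t \<in> {a..b}. (t, w) \<in> E} \<in> lmeasurable"
  by (intro bounded_set_imp_lmeasurable slice_bounded sets_completionI_sets) (simp add: slice_borel del: atLeastAtMost_iff)

lemma slice_measure_le_length: "a \<le> b \<Longrightarrow> slice_measure E w a b \<le> b - a"
  using measure_mono_fmeasurable[of "{t \<in> {a..b}. (t, w) \<in> E}" "{a..b}" lebesgue]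
    fmeasurableD[OF slice_lmeasurable[of a b w]]
  unfolding slice_measure_def by (simp add: subset_iff)

lemma slice_measure_nonneg: "0 \<le> slice_measure E w a b"
  by (simp add: slice_measure_def)

text \<open>The two pieces need not cover the segment: a gap that misses \<open>E\<close> may lie
  between them.\<close>

lemma slice_measure_le_sum:
  assumes "\<And>t. t \<in> {a..b} \<Longrightarrow> (t, w) \<in> E \<Longrightarrow> t \<in> {a..l} \<or> t \<in> {r..b}"
  shows "slice_measure E w a b \<le> slice_measure E w a l + slice_measure E w r b"
proof -
  let ?X = "\<lambda>a b. {t \<in> {a..b}. (t, w) \<in> E}"
  have "measure lebesgue (?X a b) \<le> measure lebesgue (?X a l \<union> ?X r b)"
    using assms by (intro measure_mono_fmeasurable fmeasurable.Un fmeasurableD slice_lmeasurable) blast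
  also have "\<dots> \<le> measure lebesgue (?X a l) + measure lebesgue (?X r b)"
    by (intro measure_Un_le fmeasurableD slice_lmeasurable)
  finally show ?thesis by (simp add: slice_measure_def)
qed

lemma slice_measure_image:
  assumes "m \<noteq> 0" "\<And>t. t \<in> {a..b} \<Longrightarrow> (t, w) \<in> E \<Longrightarrow> m * t + d \<in> {a'..b'} \<and> (m * t + d, w') \<in> E"
  shows "slice_measure E w a b \<le> slice_measure E w' a' b' / \<bar>m\<bar>"
  unfolding slice_measure_def
proof (rule measure_le_affine[where d = d, OF assms(1)])
  show "m * t + d \<in> {t \<in> {a'..b'}. (t, w') \<in> E}" if "t \<in> {t \<in> {a..b}. (t, w) \<in> E}" for t
    using that assms(2)[of t] by blast
qed (intro slice_borel slice_bounded)+

text \<open>Here the minimum is the running coordinate, so the image stays horizontal and is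
  stretched by \<open>k\<close>.\<close>

lemma slice_below_diagonal:
  assumes "b \<le> w"
  shows "slice_measure E w a b \<le> slice_measure E \<bar>1 - 2 * w\<bar> (k * a) (k * b) / k"
proof -
  have "(k * t, \<bar>1 - 2 * w\<bar>) \<in> E" if "t \<in> {a..b}" "(t, w) \<in> E" for t
    using invariant[OF that(2)] that(1) assms by (simp add: folded_tent_def min_def max_def)
  then show ?thesis
    using slice_measure_image[of k a b w 0 "k * a" "k * b" "\<bar>1 - 2 * w\<bar>"] k
    by (auto intro!: mult_left_mono)
qed

text \<open>Here the maximum is the running coordinate, so the image is vertical and
  \<open>swap\<close> makes it horizontal again. Left of 1/2 the slope is -2, which exchanges the
  endpoints.\<close>

lemma slice_above_diagonal_left:
  assumes "w \<le> a" "b \<le> 1/2"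
  shows "slice_measure E w a b \<le> slice_measure E (k * w) (1 - 2 * b) (1 - 2 * a) / 2"
proof -
  have "(1 - 2 * t, k * w) \<in> E" if "t \<in> {a..b}" "(t, w) \<in> E" for t
  proof -
    have "folded_tent k (t, w) = (k * w, 1 - 2 * t)"
      using that(1) assms by (auto simp: folded_tent_def)
    then show ?thesis using invariant[OF that(2)] swap by metis
  qed
  then show ?thesis
    using slice_measure_image[of "-2" a b w 1 "1 - 2 * b" "1 - 2 * a" "k * w"] by auto
qed

lemma slice_above_diagonal_right:
  assumes "w \<le> a" "1/2 \<le> a"
  shows "slice_measure E w a b \<le> slice_measure E (k * w) (2 * a - 1) (2 * b - 1) / 2"
proof -
  have "(2 * t - 1, k * w) \<in> E" if "t \<in> {a..b}" "(t, w) \<in> E" for t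
  proof -
    have "folded_tent k (t, w) = (k * w, 2 * t - 1)"
      using that(1) assms by (auto simp: folded_tent_def)
    then show ?thesis using invariant[OF that(2)] swap by metis
  qed
  then show ?thesis
    using slice_measure_image[of 2 a b w "-1" "2 * a - 1" "2 * b - 1" "k * w"] by auto
qed

text \<open>The point \<open>(1/2, w)\<close> reaches \<open>p = 0\<close> in two steps, so a whole
  neighbourhood of it misses \<open>E\<close>.\<close>

lemma trapped_away_from_half:
  assumes "(t, w) \<in> E" "0 \<le> w" "w \<le> 1/2"
  shows "\<epsilon> / 4 \<le> \<bar>t - 1/2\<bar>"
proof -
  have "\<epsilon> \<le> k * \<bar>1 - 2 * max t w\<bar>"
  proof -
    have "\<epsilon> \<le> k * min (k * min t w) \<bar>1 - 2 * max t w\<bar>"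
      using away[OF assms(1)] by (simp add: folded_tent_def)
    also have "\<dots> \<le> k * \<bar>1 - 2 * max t w\<bar>" using k by (intro mult_left_mono) auto
    finally show ?thesis .
  qed
  also have "\<dots> \<le> 2 * \<bar>1 - 2 * max t w\<bar>" using k by (intro mult_right_mono) auto
  \<comment> \<open>If the maximum is \<open>w\<close> rather than \<open>t\<close>, then
    \<open>t \<le> w \<le> 1/2\<close>, so \<open>t\<close> is at least as far from 1/2 as
    \<open>w\<close> is.\<close>
  finally show ?thesis using assms(3) by (auto simp: max_def abs_if split: if_splits)
qed

text \<open>The window of radius \<open>\<epsilon> / 4\<close> about 1/2 misses \<open>E\<close>.
  Its part inside the segment has length at least the minimum of \<open>b - a\<close> and
  \<open>\<epsilon> / 4\<close>, hence at least \<open>\<epsilon> / 4 * (b - a)\<close> because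
  \<open>b - a\<close> and \<open>\<epsilon>\<close> are at most 1. The old bound is applied to the
  two remaining pieces.\<close>

lemma slice_through_half:
  assumes \<theta>: "\<And>w a b. valid_slice w a b \<Longrightarrow> slice_measure E w a b \<le> \<theta> * (b - a)" "0 \<le> \<theta>"
    and v: "valid_slice w a b" "w \<le> 1/2" "a \<le> 1/2" "1/2 \<le> b"
  shows "slice_measure E w a b \<le> \<theta> * (1 - \<epsilon> / 4) * (b - a)"
proof -
  define l r where "l = max a (1/2 - \<epsilon>/4)" and "r = min b (1/2 + \<epsilon>/4)"
  have "slice_measure E w a b \<le> slice_measure E w a l + slice_measure E w r b"
    using trapped_away_from_half[of _ w] v
    by (intro slice_measure_le_sum) (force simp: l_def r_def valid_slice_def abs_if split: if_splits)
  also have "\<dots> \<le> \<theta> * (l - a) + \<theta> * (b - r)"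
    using v \<epsilon> by (intro add_mono \<theta>) (auto simp: valid_slice_def l_def r_def)
  also have "\<dots> = \<theta> * ((b - a) - (r - l))" by (simp add: algebra_simps)
  also have "\<dots> \<le> \<theta> * ((b - a) - \<epsilon> / 4 * (b - a))"
  proof -
    have "\<epsilon> / 4 * (b - a) \<le> \<epsilon> / 4" "\<epsilon> / 4 * (b - a) \<le> b - a"
      using v \<epsilon> mult_left_le[of "b - a" "\<epsilon> / 4"] mult_left_le_one_le[of "b - a" "\<epsilon> / 4"]
      by (auto simp: valid_slice_def)
    then have "\<epsilon> / 4 * (b - a) \<le> r - l"
      using v(3,4) \<epsilon>(1) unfolding l_def r_def by linarith
    then show ?thesis using \<theta>(2) by (intro mult_left_mono) auto
  qed
  finally show ?thesis by (simp add: algebra_simps)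
qed

text \<open>The term \<open>\<beta> * (b - a)\<close> is reproduced exactly when an image bound is
  divided by the expansion factor, whereas the additive error \<open>e\<close> shrinks by that
  factor, which is \<open>k\<close> or \<open>2 \<ge> k\<close>. Slices through 1/2 satisfy the
  bound without error by \<open>half\<close>.\<close>

lemma uncut_slice_step:
  assumes bound: "\<And>w a b. valid_slice w a b \<Longrightarrow> slice_measure E w a b \<le> \<beta> * (b - a) + e"
    and half: "\<And>w a b. valid_slice w a b \<Longrightarrow> w \<le> 1/2 \<Longrightarrow> a \<le> 1/2 \<Longrightarrow> 1/2 \<le> b \<Longrightarrow>
      slice_measure E w a b \<le> \<beta> * (b - a)"
    and e: "0 \<le> e" and v: "valid_slice w a b" and uncut: "b \<le> w \<or> w \<le> a"
  shows "slice_measure E w a b \<le> \<beta> * (b - a) + e / k"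
proof -
  have k0: "0 < k" using k by simp
  have "e / 2 \<le> e / k" using k k0 e by (intro divide_left_mono) auto
  have kw: "k * x \<le> 2 * x" if "0 \<le> x" for x using that k by (intro mult_right_mono) auto
  consider "b \<le> w" | "w \<le> a" "b \<le> 1/2" | "w \<le> a" "1/2 \<le> a" | "w \<le> a" "a \<le> 1/2" "1/2 \<le> b"
    using uncut by linarith
  then show ?thesis
  proof cases
    case 1
    have "k * b \<le> 2 * b" using kw v by (auto simp: valid_slice_def)
    then have "valid_slice \<bar>1 - 2 * w\<bar> (k * a) (k * b)"
      using v 1 k0 by (auto simp: valid_slice_def abs_if)
    from bound[OF this]
    have "slice_measure E \<bar>1 - 2 * w\<bar> (k * a) (k * b) / k \<le> (\<beta> * (k * b - k * a) + e) / k"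
      using k0 by (intro divide_right_mono) auto
    also have "\<dots> = \<beta> * (b - a) + e / k" using k0 by (simp add: field_simps)
    finally show ?thesis using slice_below_diagonal[OF 1, of a] by linarith
  next
    case 2
    have "k * w \<le> 2 * w" using kw v by (auto simp: valid_slice_def)
    then have "valid_slice (k * w) (1 - 2 * b) (1 - 2 * a)"
      using v 2 k0 by (auto simp: valid_slice_def)
    from bound[OF this] have "slice_measure E (k * w) (1 - 2 * b) (1 - 2 * a) / 2 \<le> \<beta> * (b - a) + e / 2"
      by (simp add: algebra_simps)
    then show ?thesis using slice_above_diagonal_left[OF 2] \<open>e / 2 \<le> e / k\<close> by linarith
  next
    case 3
    have "k * w \<le> 2 * w" using kw v by (auto simp: valid_slice_def)
    then have "valid_slice (k * w) (2 * a - 1) (2 * b - 1)"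
      using v 3 k0 by (auto simp: valid_slice_def)
    from bound[OF this] have "slice_measure E (k * w) (2 * a - 1) (2 * b - 1) / 2 \<le> \<beta> * (b - a) + e / 2"
      by (simp add: algebra_simps)
    then show ?thesis using slice_above_diagonal_right[OF 3, of b] \<open>e / 2 \<le> e / k\<close> by linarith
  next
    case 4
    then show ?thesis using half[OF v] e k0 by (simp add: add_increasing2)
  qed
qed

text \<open>A slice is cut at most once, at the diagonal; the two image pieces share the corner
  \<open>(k * w, 1 - 2 * w)\<close>, so one of them lies on one side of the diagonal and gains another
  factor \<open>1 / k\<close> in the next step. For \<open>k \<ge> 9/5\<close> one has
  \<open>1 / k + 1 / k\<^sup>2 < 7/8\<close>.\<close>

lemma slice_step:
  assumes bound: "\<And>w a b. valid_slice w a b \<Longrightarrow> slice_measure E w a b \<le> \<beta> * (b - a) + e"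
    and half: "\<And>w a b. valid_slice w a b \<Longrightarrow> w \<le> 1/2 \<Longrightarrow> a \<le> 1/2 \<Longrightarrow> 1/2 \<le> b \<Longrightarrow>
      slice_measure E w a b \<le> \<beta> * (b - a)"
    and e: "0 \<le> e" and v: "valid_slice w a b"
  shows "slice_measure E w a b \<le> \<beta> * (b - a) + 7/8 * e"
proof -
  have k0: "0 < k" using k by simp
  have uncut: "slice_measure E w a b \<le> \<beta> * (b - a) + e / k"
    if "valid_slice w a b" "b \<le> w \<or> w \<le> a" for w a b
    by (rule uncut_slice_step) (fact bound half e that)+
  have ek: "e / k \<le> 5/9 * e" "e / k / k \<le> 25/81 * e"
  proof -
    show 1: "e / k \<le> 5/9 * e" using divide_left_mono[of "9/5" k e] k e by simp
    have "e / k / k \<le> 5/9 * e / k" using 1 k0 by (intro divide_right_mono) auto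
    also have "\<dots> \<le> 5/9 * (5/9 * e)" using 1 by simp
    finally show "e / k / k \<le> 25/81 * e" by simp
  qed
  consider "b \<le> w \<or> w \<le> a" | "a < w" "w < b" "b \<le> 1/2" | "a < w" "w < b" "1/2 \<le> b" by linarith
  then show ?thesis
  proof cases
    case 1
    then show ?thesis using uncut[OF v] ek e by linarith
  next
    case 3
    then have "w \<le> 1/2" "a \<le> 1/2" using v by (auto simp: valid_slice_def)
    then show ?thesis using half[OF v] 3 e by linarith
  next
    case 2
    define Q where "Q = 1 - 2 * w"
    have Q: "\<bar>1 - 2 * w\<bar> = Q" using 2 by (simp add: Q_def)
    have kw: "k * w \<le> 2 * w" "k * a \<le> k * w" using k 2 v by (auto simp: valid_slice_def)
    have v1: "valid_slice Q (k * a) (k * w)" and v2: "valid_slice (k * w) (1 - 2 * b) Q"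
      using v 2 kw k0 by (auto simp: valid_slice_def Q_def)
    have split: "slice_measure E w a b \<le> slice_measure E w a w + slice_measure E w w b"
      by (rule slice_measure_le_sum) auto
    have s1: "slice_measure E w a w \<le> slice_measure E Q (k * a) (k * w) / k"
      using slice_below_diagonal[of w w a] by (simp add: Q)
    have s2: "slice_measure E w w b \<le> slice_measure E (k * w) (1 - 2 * b) Q / 2"
      using slice_above_diagonal_left[of w w b] 2 by (simp add: Q_def)
    have "slice_measure E Q (k * a) (k * w) / k + slice_measure E (k * w) (1 - 2 * b) Q / 2
      \<le> \<beta> * (b - a) + 7/8 * e"
    \<comment> \<open>If \<open>k * w \<le> Q\<close>, the piece at height \<open>Q\<close> is uncut
      and the errors add up to at most \<open>e / k\<^sup>2 + e / 2\<close>; otherwise the piece at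
      height \<open>k * w\<close> is uncut and they add up to at most
      \<open>e / k + e / (2 * k)\<close>.\<close>
    proof (cases "k * w \<le> Q")
      case True
      have "slice_measure E Q (k * a) (k * w) / k \<le> (\<beta> * (k * w - k * a) + e / k) / k"
        using uncut[OF v1] True k0 by (intro divide_right_mono) auto
      also have "\<dots> = \<beta> * (w - a) + e / k / k" using k0 by (simp add: field_simps)
      finally show ?thesis using bound[OF v2] ek e by (simp add: Q_def algebra_simps)
    next
      case False
      have "slice_measure E Q (k * a) (k * w) / k \<le> (\<beta> * (k * w - k * a) + e) / k"
        using bound[OF v1] k0 by (intro divide_right_mono) auto
      also have "\<dots> = \<beta> * (w - a) + e / k" using k0 by (simp add: field_simps)
      finally show ?thesis using uncut[OF v2] False ek e by (simp add: Q_def algebra_simps)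
    qed
    with split s1 s2 show ?thesis by linarith
  qed
qed

text \<open>Slices through 1/2 already have the better constant. For the others, start from that
  constant with additive error \<open>\<theta>\<close>, valid since \<open>b - a \<le> 1\<close>,
  and let \<open>slice_step\<close> drive the error to 0.\<close>

lemma slice_measure_improve:
  assumes \<theta>: "\<And>w a b. valid_slice w a b \<Longrightarrow> slice_measure E w a b \<le> \<theta> * (b - a)" "0 \<le> \<theta>"
    and v: "valid_slice w a b"
  shows "slice_measure E w a b \<le> \<theta> * (1 - \<epsilon> / 4) * (b - a)"
proof -
  let ?\<beta> = "\<theta> * (1 - \<epsilon> / 4)"
  have "\<forall>w a b. valid_slice w a b \<longrightarrow> slice_measure E w a b \<le> ?\<beta> * (b - a) + (7/8) ^ n * \<theta>" for n
  proof (induction n)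
    case 0
    have "\<theta> * (b - a) \<le> ?\<beta> * (b - a) + \<theta>" if "valid_slice w a b" for w a b
    proof -
      have "\<theta> * (b - a) \<le> \<theta>" "0 \<le> ?\<beta> * (b - a)"
        using that \<theta>(2) \<epsilon> mult_left_le[of "b - a" \<theta>]
        by (auto simp: valid_slice_def intro!: mult_nonneg_nonneg)
      then show ?thesis by linarith
    qed
    then show ?case by (auto intro: order_trans[OF \<theta>(1)])
  next
    case (Suc n)
    have "slice_measure E w a b \<le> ?\<beta> * (b - a) + 7/8 * ((7/8) ^ n * \<theta>)" if "valid_slice w a b" for w a b
      using Suc \<theta> slice_through_half[OF \<theta>] that by (intro slice_step) auto
    then show ?case by (simp add: mult.assoc)
  qed
  then have le: "slice_measure E w a b \<le> ?\<beta> * (b - a) + (7/8) ^ n * \<theta>" for n using v by blast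
  have "(\<lambda>n. ?\<beta> * (b - a) + (7/8) ^ n * \<theta>) \<longlonglongrightarrow> ?\<beta> * (b - a) + 0 * \<theta>"
    by (intro tendsto_intros LIMSEQ_power_zero) auto
  then show ?thesis using le by (intro LIMSEQ_le_const[of _ "?\<beta> * (b - a)"]) auto
qed

text \<open>Improving the trivial constant 1 repeatedly gives a geometric sequence of constants with
  limit 0.\<close>

lemma slice_measure_eq_0:
  assumes "valid_slice w a b"
  shows "slice_measure E w a b = 0"
proof -
  have "\<forall>w a b. valid_slice w a b \<longrightarrow> slice_measure E w a b \<le> (1 - \<epsilon> / 4) ^ n * (b - a)" for n
  proof (induction n)
    case 0
    then show ?case using slice_measure_le_length by (auto simp: valid_slice_def)
  next
    case (Suc n)
    then show ?case
      using slice_measure_improve[of "(1 - \<epsilon> / 4) ^ n"] \<epsilon> by (auto simp: mult.commute)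
  qed
  then have le: "slice_measure E w a b \<le> (1 - \<epsilon> / 4) ^ n * (b - a)" for n using assms by blast
  have "(\<lambda>n. (1 - \<epsilon> / 4) ^ n * (b - a)) \<longlonglongrightarrow> 0 * (b - a)"
    using \<epsilon> by (intro tendsto_intros LIMSEQ_power_zero) auto
  then have "slice_measure E w a b \<le> 0" using le by (intro LIMSEQ_le_const[of _ 0]) auto
  then show ?thesis using slice_measure_nonneg[of w a b] by linarith
qed

text \<open>Fubini: the section at height \<open>w\<close> is the slice from 0 to
  \<open>1 - w\<close>, which is null.\<close>

lemma negligible_trapped: "negligible (E \<inter> sym_triangle)"
proof -
  have B: "E \<inter> sym_triangle \<in> sets borel"
    using borel by (simp add: borel_closed closed_sym_triangle sets.Int)
  then have B': "E \<inter> sym_triangle \<in> sets (lborel \<Otimes>\<^sub>M lborel)"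
    by (simp only: lborel_prod sets_lborel)
  have "emeasure lborel ((\<lambda>t. (t, w)) -` (E \<inter> sym_triangle)) = 0" for w
  proof (cases "0 \<le> w \<and> w \<le> 1")
    case True
    have "{t \<in> {0..1 - w}. (t, w) \<in> E} = (\<lambda>t. (t, w)) -` (E \<inter> sym_triangle)"
      using True by (auto simp: sym_triangle_def)
    moreover have "emeasure lebesgue {t \<in> {0..1 - w}. (t, w) \<in> E} = 0"
      using slice_measure_eq_0[of w 0 "1 - w"] True slice_lmeasurable[of 0 "1 - w" w]
      by (simp add: slice_measure_def valid_slice_def emeasure_eq_measure2)
    moreover have "(\<lambda>t. (t, w)) -` (E \<inter> sym_triangle) \<in> sets borel"
      using measurable_sets[OF _ B, of "\<lambda>t. (t, w)" borel] by simp
    ultimately show ?thesis by simp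
  next
    case False
    then have "(\<lambda>t. (t, w)) -` (E \<inter> sym_triangle) = {}" by (auto simp: sym_triangle_def)
    then show ?thesis by simp
  qed
  then have "emeasure (lborel \<Otimes>\<^sub>M lborel) (E \<inter> sym_triangle) = 0"
    by (subst lborel_pair.emeasure_pair_measure_alt2[OF B']) simp
  then show ?thesis
    using B by (auto simp: lborel_prod negligible_iff_null_sets null_sets_def)
qed

end

section \<open>Area estimate for orbits that stay near the diagonal\<close>

text \<open>Change of variables for a diagonal affine map. The bound 18/5 is the value of the
  Jacobian \<open>2 * k\<close> at \<open>k = 9/5\<close>.\<close>

lemma emeasure_affine_vimage:
  fixes B :: "(real \<times> real) set"
  assumes "B \<in> sets borel" "18/5 \<le> \<bar>m1\<bar> * \<bar>m2\<bar>"
  shows "emeasure lborel ((\<lambda>z. (m1 * fst z + d1, m2 * snd z + d2)) -` B) \<le> ennreal (5/18) * emeasure lborel B"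
proof -
  let ?T = "\<lambda>z::real\<times>real. (m1 * fst z + d1, m2 * snd z + d2)"
  define c :: "real \<times> real \<Rightarrow> real" where "c j = (if j = (1, 0) then m1 else m2)" for j
  have m: "m1 \<noteq> 0" "m2 \<noteq> 0" using assms(2) by auto
  have Basis: "(Basis :: (real \<times> real) set) = {(1, 0), (0, 1)}"
    by (auto simp: Basis_prod_def)
  have T: "?T = (\<lambda>z. (d1, d2) + (\<Sum>j\<in>Basis. (c j * (z \<bullet> j)) *\<^sub>R j))"
    by (auto simp: Basis c_def)
  have meas: "?T \<in> borel \<rightarrow>\<^sub>M borel"
    by (intro borel_measurable_continuous_onI continuous_intros)
  have "emeasure lborel B = emeasure (density (distr lborel borel ?T) (\<lambda>_. \<Prod>j\<in>Basis. \<bar>c j\<bar>)) B"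
    unfolding T by (subst lborel_affine_euclidean[of c "(d1, d2)"]) (auto simp: Basis c_def m)
  also have "\<dots> = ennreal (\<bar>m1\<bar> * \<bar>m2\<bar>) * emeasure lborel (?T -` B)"
    using assms(1) meas
    by (subst emeasure_density) (auto simp: nn_integral_cmult emeasure_distr Basis c_def)
  finally have eq: "emeasure lborel B = ennreal (\<bar>m1\<bar> * \<bar>m2\<bar>) * emeasure lborel (?T -` B)" .
  have "ennreal (5/18 * (\<bar>m1\<bar> * \<bar>m2\<bar>)) = ennreal (5/18) * ennreal (\<bar>m1\<bar> * \<bar>m2\<bar>)"
    by (rule ennreal_mult) auto
  then have "ennreal (5/18) * emeasure lborel B =
      ennreal (5/18 * (\<bar>m1\<bar> * \<bar>m2\<bar>)) * emeasure lborel (?T -` B)"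
    by (simp only: eq mult.assoc)
  moreover have "ennreal 1 \<le> ennreal (5/18 * (\<bar>m1\<bar> * \<bar>m2\<bar>))"
    using assms(2) by (intro ennreal_leI) simp
  then have "ennreal 1 * emeasure lborel (?T -` B) \<le> ennreal (5/18 * (\<bar>m1\<bar> * \<bar>m2\<bar>)) * emeasure lborel (?T -` B)"
    by (rule mult_right_mono) simp
  ultimately show ?thesis by simp
qed

lemma emeasure_swap_vimage:
  fixes B :: "(real \<times> real) set"
  assumes "B \<in> sets borel"
  shows "emeasure lborel (prod.swap -` B) = emeasure lborel B"
proof -
  have swap: "(\<lambda>(x, y). (y, x)) = (prod.swap :: real \<times> real \<Rightarrow> _)" by auto
  have distr: "lborel = distr lborel lborel (prod.swap :: real \<times> real \<Rightarrow> _)"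
    unfolding swap[symmetric] using lborel_pair.distr_pair_swap unfolding lborel_prod .
  have "emeasure lborel B = emeasure (distr lborel lborel prod.swap) B"
    by (subst distr[symmetric]) (rule refl)
  also have "\<dots> = emeasure lborel (prod.swap -` B)"
    using assms by (subst emeasure_distr)
      (auto intro!: borel_measurable_continuous_onI continuous_intros)
  finally show ?thesis by simp
qed

text \<open>The threshold 1/4 lies below the fold at 1/2. The finite horizon \<open>n\<close> makes
  a decay rate in \<open>n\<close> available.\<close>

definition synced :: "real \<Rightarrow> nat \<Rightarrow> (real \<times> real) set" where
  "synced k n = {z \<in> sym_triangle. \<forall>j\<le>n. fst ((folded_tent k ^^ j) z) \<le> 1/4}"

lemma closed_synced: "closed (synced k n)"
proof -
  have "synced k n = sym_triangle \<inter> {z. \<forall>j\<in>{..n}. fst ((folded_tent k ^^ j) z) \<le> 1/4}"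
    by (auto simp: synced_def)
  moreover have "closed {z. \<forall>j\<in>{..n}. fst ((folded_tent k ^^ j) z) \<le> 1/4}"
    unfolding Ball_def
    by (intro closed_Collect_all closed_Collect_imp closed_Collect_le continuous_intros
      continuous_folded_tent_pow open_Collect_const)
  ultimately show ?thesis by (simp add: closed_Int closed_sym_triangle)
qed

text \<open>Only three of the four affine branches of the map meet the strip \<open>{z. fst z \<le> 1/4}\<close>,
  and each has Jacobian \<open>2 * k > 3\<close>.\<close>

lemma emeasure_synced_Suc:
  assumes "9/5 \<le> k" "k \<le> 2"
  shows "emeasure lborel (synced k (Suc n)) \<le> ennreal (5/6) * emeasure lborel (synced k n)"
proof -
  let ?L = "\<lambda>s d (z::real\<times>real). (k * fst z + 0, s * snd z + d)"
  let ?B = "synced k n"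
  have B: "?B \<in> sets borel" using closed_synced by (rule borel_closed)
  have meas: "?L s d -` ?B \<in> sets borel" for s d
  proof -
    have "?L s d \<in> borel \<rightarrow>\<^sub>M borel"
      by (intro borel_measurable_continuous_onI continuous_intros)
    from measurable_sets[OF this B] show ?thesis by simp
  qed
  have meas': "prod.swap -` ?L s d -` ?B \<in> sets borel" for s d
  proof -
    have "(prod.swap :: real \<times> real \<Rightarrow> _) \<in> borel \<rightarrow>\<^sub>M borel"
      by (intro borel_measurable_continuous_onI continuous_intros)
    from measurable_sets[OF this meas] show ?thesis by simp
  qed
  have sub: "synced k (Suc n) \<subseteq> (?L (-2) 1 -` ?B \<union> ?L 2 (-1) -` ?B) \<union> prod.swap -` ?L (-2) 1 -` ?B"
  proof
    fix z assume z: "z \<in> synced k (Suc n)"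
    have "fst ((folded_tent k ^^ j) (folded_tent k z)) \<le> 1/4" if "j \<le> n" for j
      using z that unfolding synced_def
      by (metis (mono_tags, lifting) Suc_le_mono comp_apply funpow_Suc_right mem_Collect_eq)
    then have "folded_tent k z \<in> ?B"
      using z assms by (auto simp: synced_def intro: folded_tent_in_triangle)
    moreover have "fst z \<le> 1/4" using z by (force simp: synced_def)
    \<comment> \<open>When \<open>q\<close> is the maximum it may lie on either side of 1/2; when
      \<open>p\<close> is the maximum, \<open>p \<le> 1/4\<close> forces the decreasing
      branch.\<close>
    then have "folded_tent k z = ?L (-2) 1 z \<or> folded_tent k z = ?L 2 (-1) z \<or>
        folded_tent k z = ?L (-2) 1 (prod.swap z)"
      by (cases z) (auto simp: folded_tent_def min_def max_def abs_if)
    ultimately show "z \<in> (?L (-2) 1 -` ?B \<union> ?L 2 (-1) -` ?B) \<union> prod.swap -` ?L (-2) 1 -` ?B"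
      by (metis (no_types, lifting) UnCI vimageI)
  qed
  have "emeasure lborel (synced k (Suc n)) \<le>
      emeasure lborel ((?L (-2) 1 -` ?B \<union> ?L 2 (-1) -` ?B) \<union> prod.swap -` ?L (-2) 1 -` ?B)"
    by (intro emeasure_mono sub) (unfold sets_lborel, intro sets.Un meas meas')
  also have "\<dots> \<le> emeasure lborel (?L (-2) 1 -` ?B \<union> ?L 2 (-1) -` ?B) + emeasure lborel (prod.swap -` ?L (-2) 1 -` ?B)"
    by (rule emeasure_subadditive; unfold sets_lborel; intro sets.Un meas meas')
  also have "\<dots> \<le> (emeasure lborel (?L (-2) 1 -` ?B) + emeasure lborel (?L 2 (-1) -` ?B))
      + emeasure lborel (prod.swap -` ?L (-2) 1 -` ?B)"
    by (rule add_right_mono, rule emeasure_subadditive; unfold sets_lborel; rule meas)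
  \<comment> \<open>Three branches, each contributing at most 5/18 of the area, give the factor
    5/6.\<close>
  also have "\<dots> \<le> (ennreal (5/18) * emeasure lborel ?B + ennreal (5/18) * emeasure lborel ?B)
      + ennreal (5/18) * emeasure lborel ?B"
    unfolding emeasure_swap_vimage[OF meas]
    using assms by (intro add_mono emeasure_affine_vimage[OF B]) auto
  also have "\<dots> = ennreal (5/6) * emeasure lborel ?B"
    by (simp flip: distrib_right ennreal_plus)
  finally show ?thesis .
qed

lemma negligible_synced_forever:
  assumes "9/5 \<le> k" "k \<le> 2"
  shows "negligible (\<Inter>n. synced k n)"
proof -
  have "emeasure lborel (synced k n) \<le> ennreal ((5/6) ^ n)" for n
  proof (induction n)
    case 0
    have "synced k 0 \<subseteq> cbox (0, 0) (1, 1)"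
      by (auto simp: synced_def sym_triangle_def cbox_Pair_eq)
    then have "emeasure lborel (synced k 0) \<le> emeasure lborel (cbox (0::real, 0::real) (1, 1))"
      by (intro emeasure_mono) auto
    also have "\<dots> = 1"
      by (simp add: emeasure_lborel_cbox_eq Basis_prod_def)
    finally show ?case by simp
  next
    case (Suc n)
    have "emeasure lborel (synced k (Suc n)) \<le> ennreal (5/6) * ennreal ((5/6) ^ n)"
      using emeasure_synced_Suc[OF assms, of n] mult_left_mono[OF Suc, of "ennreal (5/6)"]
      by (auto intro: order_trans)
    then show ?case by (simp flip: ennreal_mult)
  qed
  moreover have "emeasure lborel (\<Inter>n. synced k n) \<le> emeasure lborel (synced k n)" for n
    using closed_synced by (intro emeasure_mono) auto
  ultimately have "emeasure lborel (\<Inter>n. synced k n) \<le> ennreal ((5/6) ^ n)" for n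
    by (meson order_trans)
  moreover have "(\<lambda>n. ennreal ((5/6) ^ n)) \<longlonglongrightarrow> ennreal 0"
    by (intro tendsto_ennrealI LIMSEQ_power_zero) auto
  ultimately have "emeasure lborel (\<Inter>n. synced k n) \<le> ennreal 0"
    by (intro LIMSEQ_le_const) auto
  moreover have "(\<Inter>n. synced k n) \<in> sets borel"
    using closed_synced by (intro borel_closed closed_INT) auto
  ultimately show ?thesis by (auto simp: negligible_iff_null_sets null_sets_def)
qed

section \<open>Orbits that stay away from the diagonal\<close>

text \<open>Time 0 is left out so that the set is symmetric: \<open>folded_tent\<close> takes the
  same value at \<open>(p, q)\<close> and \<open>(q, p)\<close>, but \<open>fst\<close> itself does
  not.\<close>

definition unsynced :: "real \<Rightarrow> real \<Rightarrow> (real \<times> real) set" where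
  "unsynced k \<epsilon> = {z. \<forall>n\<ge>1. \<epsilon> \<le> fst ((folded_tent k ^^ n) z)}"

lemma negligible_unsynced:
  assumes "9/5 \<le> k" "k \<le> 2" "0 < \<epsilon>" "\<epsilon> \<le> 1"
  shows "negligible (unsynced k \<epsilon> \<inter> sym_triangle)"
proof -
  interpret folded_tent_trapped k "unsynced k \<epsilon>" \<epsilon>
  proof
    show "unsynced k \<epsilon> \<in> sets borel"
      unfolding unsynced_def
      by (intro borel_closed closed_Collect_all closed_Collect_imp closed_Collect_le continuous_intros
        continuous_folded_tent_pow open_Collect_const)
    show "(q, p) \<in> unsynced k \<epsilon>" if "(p, q) \<in> unsynced k \<epsilon>" for p q
    proof -
      have "(folded_tent k ^^ n) (q, p) = (folded_tent k ^^ n) (p, q)" if "1 \<le> n" for n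
        using that folded_tent_swap[of k p q] by (cases n) (auto simp: funpow_Suc_right simp del: funpow.simps)
      then show ?thesis using that by (simp add: unsynced_def)
    qed
    show "folded_tent k z \<in> unsynced k \<epsilon>" if z: "z \<in> unsynced k \<epsilon>" for z
    proof -
      have "\<epsilon> \<le> fst ((folded_tent k ^^ n) (folded_tent k z))" for n
        using z unfolding unsynced_def
        by (metis (mono_tags, lifting) comp_apply funpow_Suc_right le_add1 mem_Collect_eq plus_1_eq_Suc)
      then show ?thesis by (simp add: unsynced_def)
    qed
    show "\<epsilon> \<le> fst (folded_tent k (folded_tent k z))" if z: "z \<in> unsynced k \<epsilon>" for z
    proof -
      have "\<epsilon> \<le> fst ((folded_tent k ^^ 2) z)" using z unfolding unsynced_def by auto
      then show ?thesis by (simp add: eval_nat_numeral)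
    qed
  qed (use assms in auto)
  show ?thesis by (rule negligible_trapped)
qed

section \<open>Lower and upper limits, and the conclusion\<close>

lemma liminf_ereal_eq_0I:
  assumes "\<And>n. 0 \<le> u n" "\<And>\<epsilon>. 0 < \<epsilon> \<Longrightarrow> \<exists>\<^sub>F n in sequentially. u n < \<epsilon>"
  shows "liminf (\<lambda>n. ereal (u n)) = 0"
proof (rule antisym)
  show "liminf (\<lambda>n. ereal (u n)) \<le> 0"
  proof (rule ccontr)
    assume "\<not> ?thesis"
    then have "0 < liminf (\<lambda>n. ereal (u n))" by simp
    then obtain \<epsilon> where \<epsilon>: "0 < ereal \<epsilon>" "ereal \<epsilon> < liminf (\<lambda>n. ereal (u n))"
      using ereal_dense2 by blast
    from less_LiminfD[OF \<epsilon>(2)] have "\<forall>\<^sub>F n in sequentially. \<epsilon> < u n" by simp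
    moreover have "\<exists>\<^sub>F n in sequentially. u n < \<epsilon>" using \<epsilon>(1) by (intro assms) simp
    ultimately have "\<exists>\<^sub>F n in sequentially. u n < \<epsilon> \<and> \<epsilon> < u n"
      by (rule frequently_eventually_frequently[rotated])
    then have "\<exists>\<^sub>F n in sequentially. False" by (rule frequently_elim1) auto
    then show False by simp
  qed
  show "0 \<le> liminf (\<lambda>n. ereal (u n))"
    using assms(1) by (intro Liminf_bounded) simp
qed

lemma limsup_ereal_geI:
  assumes "\<exists>\<^sub>F n in sequentially. \<gamma> \<le> u n"
  shows "ereal \<gamma> \<le> limsup (\<lambda>n. ereal (u n))"
proof (rule ccontr)
  assume "\<not> ?thesis"
  then have "\<forall>\<^sub>F n in sequentially. ereal (u n) < ereal \<gamma>" by (intro Limsup_lessD) simp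
  with assms show False by (simp add: frequently_def not_le)
qed

theorem theorem1p1:
  shows "\<exists>c\<^sub>p::real. 0 < c\<^sub>p \<and> c\<^sub>p \<le> 1/4 \<and>
    (\<forall>c::real. 0 \<le> c \<and> c < c\<^sub>p \<longrightarrow>
      (\<exists>\<gamma>\<^sub>0::real. \<gamma>\<^sub>0 > 0 \<and>
        (AE x in lebesgue_on unit_square.
           liminf (\<lambda>n. ereal (infdist ((coupled_tent c ^^ n) x) D_syn)) = 0 \<and>
           limsup (\<lambda>n. ereal (infdist ((coupled_tent c ^^ n) x) D_syn)) \<ge> ereal \<gamma>\<^sub>0)))"
proof (rule exI[of _ "1/20"], intro conjI allI impI)
  fix c :: real assume c: "0 \<le> c \<and> c < 1/20"
  define k where "k = 2 * (1 - 2 * c)"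
  \<comment> \<open>The choice 1/20 is what guarantees
    \<open>2 * (1 - 2 * c) \<ge> 9/5\<close>.\<close>
  have k: "9/5 \<le> k" "k \<le> 2" using c by (auto simp: k_def)
  define N where "N = (\<Inter>n. synced k n) \<union> (\<Union>m. unsynced k (1 / real (Suc m)) \<inter> sym_triangle)"
  have "negligible (unsynced k (1 / real (Suc m)) \<inter> sym_triangle)" for m
    using k by (intro negligible_unsynced) auto
  then have "negligible N"
    unfolding N_def by (intro negligible_Un negligible_synced_forever[OF k] negligible_countable_Union) auto
  \<comment> \<open>Both assertions concern tails of the orbit: a failure only forces some iterate,
    not the initial point, into \<open>N\<close>. Hence preimages under all iterates are
    discarded.\<close>
  then have "negligible (sym_coords -` (folded_tent k ^^ n) -` N)" for n
    using k by (intro negligible_sym_coords_vimage negligible_folded_tent_pow_vimage) auto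
  then have neg: "negligible (\<Union>n. sym_coords -` (folded_tent k ^^ n) -` N)"
    by (intro negligible_countable_Union) auto
  have main: "liminf (\<lambda>n. ereal (infdist ((coupled_tent c ^^ n) x) D_syn)) = 0 \<and>
      ereal (1/8) \<le> limsup (\<lambda>n. ereal (infdist ((coupled_tent c ^^ n) x) D_syn))"
    if x: "x \<in> unit_square" "x \<notin> (\<Union>n. sym_coords -` (folded_tent k ^^ n) -` N)" for x
  proof -
    define z where "z = sym_coords x"
    define u where "u n = infdist ((coupled_tent c ^^ n) x) D_syn" for n
    define p where "p n = fst ((folded_tent k ^^ n) z)" for n
    have sc: "sym_coords ((coupled_tent c ^^ n) x) = (folded_tent k ^^ n) z" for n
      using c by (simp add: sym_coords_coupled_tent_pow k_def z_def)
    have "(coupled_tent c ^^ n) x \<in> unit_square" for n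
      using c x by (intro coupled_tent_pow_in_unit_square) auto
    then have u: "u n \<le> p n" "p n / 2 \<le> u n" for n
      using infdist_D_syn_le infdist_D_syn_ge sc by (metis u_def p_def)+
    have notN: "(folded_tent k ^^ n) z \<notin> N" for n using x(2) by (auto simp: z_def)
    have tri: "(folded_tent k ^^ n) z \<in> sym_triangle" for n
      using k x(1) by (intro folded_tent_pow_in_triangle) (auto simp: z_def sym_coords_in_triangle)
    have shift: "fst ((folded_tent k ^^ j) ((folded_tent k ^^ n) z)) = p (j + n)" for j n
      by (simp add: p_def funpow_add)
    have "\<exists>\<^sub>F n in sequentially. p n < \<epsilon>" if pos: "0 < \<epsilon>" for \<epsilon>
      unfolding frequently_sequentially
    proof
      fix n
      obtain m where m: "1 / real (Suc m) < \<epsilon>" by (rule nat_approx_posE[OF pos])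
      have "(folded_tent k ^^ n) z \<notin> unsynced k (1 / real (Suc m))"
        using notN[of n] tri[of n] unfolding N_def by blast
      then obtain j where "\<not> 1 / real (Suc m) \<le> fst ((folded_tent k ^^ j) ((folded_tent k ^^ n) z))"
        unfolding unsynced_def by blast
      then have "p (j + n) < 1 / real (Suc m)" unfolding shift by simp
      with m show "\<exists>i\<ge>n. p i < \<epsilon>" by (intro exI[of _ "j + n"]) auto
    qed
    then have "\<exists>\<^sub>F n in sequentially. u n < \<epsilon>" if "0 < \<epsilon>" for \<epsilon>
      using that by (blast intro: frequently_elim1 le_less_trans[OF u(1)])
    then have 1: "liminf (\<lambda>n. ereal (u n)) = 0"
      by (intro liminf_ereal_eq_0I) (auto simp: u_def infdist_nonneg)
    \<comment> \<open>Leaving every \<open>synced\<close> set means \<open>p > 1/4\<close>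
      infinitely often, and the distance to the diagonal is at least half of
      \<open>p\<close>.\<close>
    have "\<exists>\<^sub>F n in sequentially. 1/8 \<le> u n"
      unfolding frequently_sequentially
    proof
      fix n
      obtain i where "(folded_tent k ^^ n) z \<notin> synced k i" using notN[of n] unfolding N_def by blast
      then obtain j where "\<not> fst ((folded_tent k ^^ j) ((folded_tent k ^^ n) z)) \<le> 1/4"
        using tri[of n] unfolding synced_def by blast
      then have "1/4 < p (j + n)" unfolding shift by simp
      then show "\<exists>i\<ge>n. 1/8 \<le> u i" using u(2)[of "j + n"] by (intro exI[of _ "j + n"]) auto
    qed
    then have "ereal (1/8) \<le> limsup (\<lambda>n. ereal (u n))" by (rule limsup_ereal_geI)
    with 1 show ?thesis by (simp add: u_def)
  qed
  have square: "unit_square \<in> sets lebesgue"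
    unfolding unit_square_def by (intro sets_completionI_sets) (auto intro!: borel_closed closed_Times)
  have "AE x in lebesgue. x \<notin> (\<Union>n. sym_coords -` (folded_tent k ^^ n) -` N)"
    using neg by (intro AE_not_in) (simp add: negligible_iff_null_sets)
  then have "AE x in lebesgue_on unit_square.
      liminf (\<lambda>n. ereal (infdist ((coupled_tent c ^^ n) x) D_syn)) = 0 \<and>
      limsup (\<lambda>n. ereal (infdist ((coupled_tent c ^^ n) x) D_syn)) \<ge> ereal (1/8)"
    using square main by (subst AE_restrict_space_iff) (auto elim!: eventually_mono)
  then show "\<exists>\<gamma>\<^sub>0::real. \<gamma>\<^sub>0 > 0 \<and> (AE x in lebesgue_on unit_square.
      liminf (\<lambda>n. ereal (infdist ((coupled_tent c ^^ n) x) D_syn)) = 0 \<and>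
      limsup (\<lambda>n. ereal (infdist ((coupled_tent c ^^ n) x) D_syn)) \<ge> ereal \<gamma>\<^sub>0)"
    by (intro exI[of _ "1/8"] conjI) auto
qed auto

end
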